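(* Let $n\ge 2$ be an integer, let $k>0$, $a>0$, $b-a>0$, $\eta>0$ and $\zeta\ge 0$ be real numbers, and let $\phi\in(0,\infty)^n$. Then $$\frac{\beta_{\zeta,k}^{(a,b)}(\phi;\eta)}{\beta_k(\phi;\eta)}\ \ge\ {}_1F_{1,k}\!\left(b-a;b;\frac{\eta^k n^n}{k}\right)\exp\!\left(-\frac{\zeta^k}{\eta^k n^n}\right).$$
   Context: $E_{n-1}=\{(t_1,\dots,t_{n-1})\in\mathbb{R}^{n-1}: t_i\ge 0,\ \sum_{i=1}^{n-1}t_i\le 1\}$; for $t\in E_{n-1}$ put $t_n=1-\sum_{i=1}^{n-1}t_i$, $\pi(t)=\prod_{i=1}^n t_i$, $dt=dt_1\cdots dt_{n-1}$. For $c>0$, $(c)_{0,k}=1$ and $(c)_{m,k}=c(c+k)\cdots(c+(m-1)k)$ for $m\ge1$. The confluent hypergeometric $k$-function is ${}_1F_{1,k}(a;b;x)=\sum_{m=0}^\infty \frac{(a)_{m,k}}{(b)_{m,k}}\frac{x^m}{m!}$, $x\in\mathbb{R}$. For $\phi\in(0,\infty)^n$, $$\beta_{\zeta,k}^{(a,b)}(\phi;\eta)=\frac1{k^{n-1}}\int_{E_{n-1}}\prod_{i=1}^n t_i^{\frac{\phi_i}{k}-1}\;{}_1F_{1,k}\!\left(a;b;-\frac{\eta^k}{k\pi(t)}-\zeta^k\frac{\pi(t)}{\eta^k}\right)dt,$$ $$\beta_k(\phi;\eta)=\frac1{k^{n-1}}\int_{E_{n-1}}\left(\prod_{i=1}^n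 t_i^{\frac{\phi_i}{k}-1}\right)e^{-\frac{\eta^k}{k\pi(t)}}\,dt.$$ *)

theory Defs
  imports "HOL-Analysis.Analysis"
begin

definition pochhammer_k :: "real \<Rightarrow> nat \<Rightarrow> real \<Rightarrow> real" where
  "pochhammer_k c m k = (\<Prod>j<m. c + real j * k)"

definition hyp1F1_k :: "real \<Rightarrow> real \<Rightarrow> real \<Rightarrow> real \<Rightarrow> real" where
  "hyp1F1_k k a b x = (\<Sum>m. pochhammer_k a m k / pochhammer_k b m k * (x ^ m / fact m))"

text \<open>
  Points of \<open>\<real>\<^sup>d\<close> are extensional functions on \<open>{1..d}\<close>, i.e. elements of the space of
  the product measure \<open>lebesgue_pow d\<close>, which is Lebesgue (Borel) measure on \<open>\<real>\<^sup>d\<close>.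
\<close>

definition lebesgue_pow :: "nat \<Rightarrow> (nat \<Rightarrow> real) measure" where
  "lebesgue_pow d = (\<Pi>\<^sub>M i\<in>{1..d}. lborel)"

definition corner_simplex :: "nat \<Rightarrow> (nat \<Rightarrow> real) set" where
  "corner_simplex d =
     {t \<in> {1..d} \<rightarrow>\<^sub>E UNIV. (\<forall>i\<in>{1..d}. 0 \<le> t i) \<and> (\<Sum>i=1..d. t i) \<le> 1}"

definition with_last :: "nat \<Rightarrow> (nat \<Rightarrow> real) \<Rightarrow> nat \<Rightarrow> real" where
  "with_last n t = t(n := 1 - (\<Sum>i=1..n-1. t i))"

definition coord_prod :: "nat \<Rightarrow> (nat \<Rightarrow> real) \<Rightarrow> real" where
  "coord_prod n t = (\<Prod>i=1..n. with_last n t i)"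

text \<open>
  In the two integrands below, the totalised values of division and \<open>powr\<close> at \<open>0\<close> only occur
  on the null set of those \<open>t\<close> with \<open>coord_prod n t = 0\<close>.
\<close>

definition beta_1F1_k ::
  "nat \<Rightarrow> real \<Rightarrow> real \<Rightarrow> real \<Rightarrow> real \<Rightarrow> (nat \<Rightarrow> real) \<Rightarrow> real \<Rightarrow> real" where
  "beta_1F1_k n k \<zeta> a b \<phi> \<eta> =
     1 / k ^ (n - 1) *
     (LINT t:corner_simplex (n - 1)|lebesgue_pow (n - 1).
        (\<Prod>i=1..n. with_last n t i powr (\<phi> i / k - 1)) *
        hyp1F1_k k a b
          (- (\<eta> powr k / (k * coord_prod n t)) - \<zeta> powr k * (coord_prod n t / \<eta> powr k)))"

definition beta_k :: "nat \<Rightarrow> real \<Rightarrow> (nat \<Rightarrow> real) \<Rightarrow> real \<Rightarrow> real" where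
  "beta_k n k \<phi> \<eta> =
     1 / k ^ (n - 1) *
     (LINT t:corner_simplex (n - 1)|lebesgue_pow (n - 1).
        (\<Prod>i=1..n. with_last n t i powr (\<phi> i / k - 1)) *
        exp (- (\<eta> powr k / (k * coord_prod n t))))"

end

theory Submission imports Defs begin

text \<open>
  Kummer's transformation turns the hypergeometric factor at \<open>-X\<close> into \<open>exp (-X)\<close> times a power
  series with nonnegative coefficients at \<open>X\<close>. By AM-GM, \<open>coord_prod n t \<le> 1 / n ^ n\<close> on the
  simplex, which bounds the series from below by its value at \<open>\<eta> powr k * n ^ n / k \<le> X\<close> and the
  \<open>\<zeta>\<close>-part of the exponential by its value at \<open>coord_prod n t = 1 / n ^ n\<close>. The resulting pointwise
  bound is integrated. Integrability of both sides has to be established because \<open>LINT\<close> is \<open>0\<close> for a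
  non-integrable function: both are dominated by the Dirichlet weight.
\<close>

section \<open>Pochhammer k-symbols and an alternating Vandermonde sum\<close>

lemma pochhammer_k_0 [simp]: "pochhammer_k c 0 k = 1"
  by (simp add: pochhammer_k_def)

lemma pochhammer_k_Suc: "pochhammer_k c (Suc m) k = pochhammer_k c m k * (c + real m * k)"
  by (simp add: pochhammer_k_def)

text \<open>Splitting off the first factor instead of the last gives the recursion that moves the
  base from \<open>c\<close> to \<open>c + k\<close>, the shift that occurs in the Vandermonde
  induction.\<close>

lemma pochhammer_k_Suc_shift: "pochhammer_k c (Suc m) k = c * pochhammer_k (c + k) m k"
  unfolding pochhammer_k_def
  by (subst prod.lessThan_Suc_shift) (simp add: algebra_simps)

lemma pochhammer_k_pos:
  assumes "c > 0" "k \<ge> 0"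
  shows "pochhammer_k c m k > 0"
  unfolding pochhammer_k_def using assms by (intro prod_pos) (simp add: add_pos_nonneg)

lemma pochhammer_k_mono:
  assumes "0 < a" "a \<le> b" "k \<ge> 0"
  shows "pochhammer_k a m k \<le> pochhammer_k b m k"
  unfolding pochhammer_k_def using assms by (intro prod_mono) auto

lemma pochhammer_k_ratio_bounds:
  assumes "0 < a" "a \<le> b" "k \<ge> 0"
  shows "0 \<le> pochhammer_k a m k / pochhammer_k b m k"
    and "pochhammer_k a m k / pochhammer_k b m k \<le> 1"
  using pochhammer_k_mono[OF assms, of m] pochhammer_k_pos[of a k m] pochhammer_k_pos[of b k m] assms
  by (auto simp: divide_simps)

text \<open>Pascal's rule, summed against an arbitrary sequence.\<close>

lemma sum_choose_Suc:
  fixes f :: "nat \<Rightarrow> real"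
  shows "(\<Sum>j\<le>Suc m. real (Suc m choose j) * f j)
    = (\<Sum>j\<le>m. real (m choose j) * f j) + (\<Sum>j\<le>m. real (m choose j) * f (Suc j))"
proof -
  have "(\<Sum>j\<le>m. real (m choose j) * f j) = (\<Sum>j\<le>Suc m. real (m choose j) * f j)"
    by simp
  also have "\<dots> = f 0 + (\<Sum>j\<le>m. real (m choose Suc j) * f (Suc j))"
    by (subst sum.atMost_Suc_shift) simp
  finally show ?thesis
    by (subst sum.atMost_Suc_shift) (simp add: sum.distrib algebra_simps)
qed

text \<open>By Pascal's rule the left-hand side \<open>S m a b\<close> satisfies \<open>S (Suc m) a b = S m a b - a / b * S m (a + k) (b + k)\<close>.\<close>
lemma pochhammer_k_vandermonde:
  assumes "b > 0" "k \<ge> 0"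
  shows "(\<Sum>j\<le>m. real (m choose j) * ((-1) ^ j * (pochhammer_k a j k / pochhammer_k b j k)))
    = pochhammer_k (b - a) m k / pochhammer_k b m k"
  using assms(1)
proof (induction m arbitrary: a b)
  case 0
  then show ?case by simp
next
  case (Suc m)
  note b = Suc.prems
  have pos: "pochhammer_k b m k > 0" "pochhammer_k (b + k) m k > 0" "b + real m * k > 0"
    using b assms(2) by (auto intro!: pochhammer_k_pos simp: add_pos_nonneg)
  have shift: "pochhammer_k b m k * (b + real m * k) = b * pochhammer_k (b + k) m k"
    using pochhammer_k_Suc pochhammer_k_Suc_shift by metis
  have "(\<Sum>j\<le>m. real (m choose j) *
      ((-1) ^ Suc j * (pochhammer_k a (Suc j) k / pochhammer_k b (Suc j) k)))
    = - (a / b) * (\<Sum>j\<le>m. real (m choose j) *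
      ((-1) ^ j * (pochhammer_k (a + k) j k / pochhammer_k (b + k) j k)))"
    by (simp add: sum_distrib_left pochhammer_k_Suc_shift mult_ac sum_negf[symmetric])
  \<comment> \<open>The difference \<open>b - a\<close> does not change when both parameters grow by
    \<open>k\<close>, so the induction hypothesis returns the same numerator.\<close>
  also have "\<dots> = - (a / b) * (pochhammer_k (b - a) m k / pochhammer_k (b + k) m k)"
    using Suc.IH[of "b + k" "a + k"] b assms(2) by simp
  finally have "(\<Sum>j\<le>Suc m. real (Suc m choose j) *
      ((-1) ^ j * (pochhammer_k a j k / pochhammer_k b j k)))
    = pochhammer_k (b - a) m k / pochhammer_k b m k
      - (a / b) * (pochhammer_k (b - a) m k / pochhammer_k (b + k) m k)"
    using Suc.IH[OF b, of a] by (subst sum_choose_Suc) simp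
  \<comment> \<open>Over the common denominator \<open>pochhammer_k b (Suc m) k\<close> the
    numerators combine to the factor \<open>(b - a) + real m * k\<close>, the next one of the symbol
    of \<open>b - a\<close>.\<close>
  also have "pochhammer_k (b - a) m k / pochhammer_k b m k
    = pochhammer_k (b - a) m k * (b + real m * k) / pochhammer_k b (Suc m) k"
    using pos by (simp add: pochhammer_k_Suc)
  also have "(a / b) * (pochhammer_k (b - a) m k / pochhammer_k (b + k) m k)
    = pochhammer_k (b - a) m k * a / pochhammer_k b (Suc m) k"
    by (simp add: pochhammer_k_Suc_shift)
  also have "pochhammer_k (b - a) m k * (b + real m * k) / pochhammer_k b (Suc m) k
      - pochhammer_k (b - a) m k * a / pochhammer_k b (Suc m) k
    = pochhammer_k (b - a) (Suc m) k / pochhammer_k b (Suc m) k"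
    by (simp add: pochhammer_k_Suc[of "b - a"] diff_divide_distrib[symmetric] algebra_simps)
  finally show ?case .
qed

section \<open>The hypergeometric k-series: convergence, bounds and Kummer's transformation\<close>

text \<open>The coefficient ratios lie between 0 and 1, so the exponential series at the absolute
  value of \<open>x\<close> is a majorant. The norm is kept because the Cauchy product needs
  absolute convergence.\<close>

lemma summable_norm_hyp1F1_k:
  assumes "0 < a" "a \<le> b" "k \<ge> 0"
  shows "summable (\<lambda>m. norm (pochhammer_k a m k / pochhammer_k b m k * (x ^ m / fact m)))"
proof (rule summable_comparison_test')
  show "summable (\<lambda>m. \<bar>x\<bar> ^ m / fact m)"
    using summable_exp[of "\<bar>x\<bar>"] by (simp add: field_simps)
  show "norm (norm (pochhammer_k a m k / pochhammer_k b m k * (x ^ m / fact m))) \<le> \<bar>x\<bar> ^ m / fact m"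
    if "m \<ge> 0" for m
    using pochhammer_k_ratio_bounds[OF assms, of m] assms
      pochhammer_k_pos[of a k m] pochhammer_k_pos[of b k m]
      mult_right_mono[of "pochhammer_k a m k / pochhammer_k b m k" 1 "\<bar>x\<bar> ^ m / fact m"]
    by (simp add: abs_mult power_abs)
qed

lemmas summable_hyp1F1_k = summable_norm_cancel[OF summable_norm_hyp1F1_k]

lemma hyp1F1_k_mono:
  assumes "0 < a" "a \<le> b" "k \<ge> 0" "0 \<le> x" "x \<le> y"
  shows "hyp1F1_k k a b x \<le> hyp1F1_k k a b y"
  unfolding hyp1F1_k_def
  using assms
  by (intro suminf_le summable_hyp1F1_k mult_left_mono divide_right_mono power_mono
        pochhammer_k_ratio_bounds) auto

lemma hyp1F1_k_ge_1:
  assumes "0 < a" "a \<le> b" "k \<ge> 0" "0 \<le> x"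
  shows "1 \<le> hyp1F1_k k a b x"
proof -
  have "hyp1F1_k k a b 0 = 1"
    by (simp add: hyp1F1_k_def)
       (subst suminf_finite[of "{0}"]; simp)
  then show ?thesis using hyp1F1_k_mono[of a b k 0 x] assms by simp
qed

text \<open>Termwise comparison, the ratios being at most 1. Through Kummer's transformation this
  becomes the upper bound 1 at negative arguments.\<close>

lemma hyp1F1_k_le_exp:
  assumes "0 < a" "a \<le> b" "k \<ge> 0" "0 \<le> x"
  shows "hyp1F1_k k a b x \<le> exp x"
proof -
  have "hyp1F1_k k a b x \<le> (\<Sum>m. x ^ m / fact m)"
    unfolding hyp1F1_k_def
  proof (intro suminf_le summable_hyp1F1_k assms)
    show "summable (\<lambda>m. x ^ m / fact m)"
      using summable_exp[of x] by (simp add: field_simps)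
    show "pochhammer_k a m k / pochhammer_k b m k * (x ^ m / fact m) \<le> x ^ m / fact m" for m
      using pochhammer_k_ratio_bounds[OF assms(1-3), of m] assms(4)
      by (intro mult_left_le_one_le) auto
  qed
  then show ?thesis by (simp add: exp_def field_simps)
qed

text \<open>Multiply the series at \<open>- x\<close> by the series of \<open>exp x\<close>: the
  coefficients of the Cauchy product are the alternating binomial sums of
  \<open>pochhammer_k_vandermonde\<close>.\<close>

lemma hyp1F1_k_kummer:
  assumes "0 < a" "a < b" "k \<ge> 0"
  shows "hyp1F1_k k a b (- x) = exp (- x) * hyp1F1_k k (b - a) b x"
proof -
  let ?f = "\<lambda>m. pochhammer_k a m k / pochhammer_k b m k * ((- x) ^ m / fact m)"
  let ?g = "\<lambda>m. x ^ m / fact m"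
  have g: "summable (\<lambda>m. norm (?g m))" "suminf ?g = exp x"
    using summable_norm_exp[of x] by (simp_all add: exp_def field_simps)
  have "(\<lambda>m. \<Sum>i\<le>m. ?f i * ?g (m - i)) sums (suminf ?f * suminf ?g)"
    using assms by (intro Cauchy_product_sums g(1) summable_norm_hyp1F1_k) auto
  moreover have "(\<Sum>i\<le>m. ?f i * ?g (m - i))
    = pochhammer_k (b - a) m k / pochhammer_k b m k * (x ^ m / fact m)" for m
  proof -
    have "?f i * ?g (m - i) = real (m choose i) *
        ((-1) ^ i * (pochhammer_k a i k / pochhammer_k b i k)) * (x ^ m / fact m)"
      if "i \<le> m" for i
    proof -
      have "x ^ m = x ^ i * x ^ (m - i)" using that by (simp flip: power_add)
      then show ?thesis
        using that by (simp add: binomial_fact power_minus[of x] field_simps)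
    qed
    then have "(\<Sum>i\<le>m. ?f i * ?g (m - i)) = (\<Sum>i\<le>m. real (m choose i) *
        ((-1) ^ i * (pochhammer_k a i k / pochhammer_k b i k))) * (x ^ m / fact m)"
      unfolding sum_distrib_right by (intro sum.cong) auto
    then show ?thesis using pochhammer_k_vandermonde[of b k m a] assms by simp
  qed
  ultimately have "hyp1F1_k k (b - a) b x = hyp1F1_k k a b (- x) * exp x"
    unfolding hyp1F1_k_def g(2) by (simp add: sums_iff)
  then show ?thesis by (simp add: exp_minus)
qed

lemma borel_measurable_hyp1F1_k [measurable]: "hyp1F1_k k a b \<in> borel_measurable borel"
  unfolding hyp1F1_k_def[abs_def] by measurable

text \<open>AM-GM, from \<open>x \<le> exp (x - 1)\<close> at \<open>x = card A * t i\<close>.\<close>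
lemma prod_le_sum_1_power_card:
  fixes t :: "'i \<Rightarrow> real"
  assumes "\<And>i. i \<in> A \<Longrightarrow> 0 \<le> t i" "(\<Sum>i\<in>A. t i) = 1"
  shows "prod t A \<le> 1 / real (card A) ^ card A"
proof -
  \<comment> \<open>Over an infinite or empty set the sum would be 0, not 1.\<close>
  have A: "finite A" "A \<noteq> {}" using assms(2) by (auto intro: ccontr)
  then have c: "real (card A) > 0" by (simp add: card_gt_0_iff)
  have "real (card A) ^ card A * prod t A = (\<Prod>i\<in>A. real (card A) * t i)"
    by (simp add: prod.distrib)
  also have "\<dots> \<le> (\<Prod>i\<in>A. exp (real (card A) * t i - 1))"
    using assms(1) exp_ge_add_one_self[of "real (card A) * t i - 1" for i]
    by (intro prod_mono) (auto simp: algebra_simps)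
  also have "\<dots> = exp (\<Sum>i\<in>A. real (card A) * t i - 1)"
    by (simp add: exp_sum A)
  also have "(\<Sum>i\<in>A. real (card A) * t i - 1) = 0"
    using assms(2) by (simp add: sum_subtractf sum_distrib_left[symmetric])
  finally show ?thesis using c by (simp add: field_simps)
qed

section \<open>Beta and Dirichlet integrals\<close>

text \<open>Substitute \<open>r * y\<close> for \<open>y\<close> in the Beta integral. The case
  \<open>r = 0\<close> is included because the fibres of the simplex degenerate to a point on its
  boundary.\<close>

lemma nn_integral_Beta_scaled:
  fixes p q r :: real
  assumes "p > 0" "q > 0" "r \<ge> 0"
  shows "(\<integral>\<^sup>+y. ennreal (indicator {0..r} y * (y powr (p - 1) * (r - y) powr (q - 1))) \<partial>lborel)
    = ennreal (Beta p q * r powr (p + q - 1))"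
proof (cases "r = 0")
  case True
  \<comment> \<open>Only \<open>y = 0\<close> lies in the interval, and there
    \<open>0 powr _ = 0\<close>; the right-hand side vanishes for the same reason.\<close>
  have "indicator {0..r} y * (y powr (p - 1) * (r - y) powr (q - 1)) = 0" for y
    using True by (auto simp: indicator_def)
  then show ?thesis unfolding True by (simp only: ennreal_0) simp
next
  case False
  then have r: "r > 0" using assms by simp
  have eq: "indicator {0..r} (0 + r * y) * ((0 + r * y) powr (p - 1) * (r - (0 + r * y)) powr (q - 1))
    = r powr (p + q - 2) * (indicator {0..1} y * (y powr (p - 1) * (1 - y) powr (q - 1)))" for y
  proof (cases "y \<in> {0..1}")
    case True
    have "r - r * y = r * (1 - y)" by (simp add: algebra_simps)
    moreover have "r powr (p + q - 2) = r powr (p - 1) * r powr (q - 1)"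
      by (simp flip: powr_add)
    ultimately show ?thesis using True r
      by (simp add: powr_mult indicator_def mult_le_cancel_left1)
  next
    case False
    then show ?thesis using r by (auto simp: indicator_def zero_le_mult_iff mult_le_cancel_left1)
  qed
  have "(\<integral>\<^sup>+y. ennreal (indicator {0..r} y * (y powr (p - 1) * (r - y) powr (q - 1))) \<partial>lborel)
    = ennreal r * (\<integral>\<^sup>+y. ennreal (r powr (p + q - 2)) *
        ennreal (indicator {0..1} y * (y powr (p - 1) * (1 - y) powr (q - 1))) \<partial>lborel)"
    using r by (subst nn_integral_real_affine[where c = r and t = 0])
      (simp_all only: eq, simp_all add: ennreal_mult)
  also have "\<dots> = ennreal r * (ennreal (r powr (p + q - 2)) * ennreal (Beta p q))"
    using nn_integral_has_integral_lebesgue[OF _ has_integral_Beta_real[OF assms(1,2)]]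
    by (subst nn_integral_cmult) simp_all
  also have "\<dots> = ennreal (Beta p q * r powr (p + q - 1))"
  proof -
    \<comment> \<open>The Jacobian \<open>r\<close> raises the exponent by one.\<close>
    have "r * r powr (p + q - 2) = r powr (p + q - 1)"
      using powr_mult_base[of r "p + q - 2"] r by (simp add: algebra_simps)
    then have eq: "Beta p q * r powr (p + q - 1) = r * (r powr (p + q - 2) * Beta p q)"
      by (metis mult.assoc mult.commute)
    show ?thesis unfolding eq using r by (simp add: ennreal_mult')
  qed
  finally show ?thesis .
qed


lemma sets_corner_simplex [measurable]: "corner_simplex d \<in> sets (lebesgue_pow d)"
proof -
  have "corner_simplex d = {t \<in> space (lebesgue_pow d).
      (\<forall>i\<in>{1..d}. 0 \<le> t i) \<and> (\<Sum>i=1..d. t i) \<le> 1}"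
    by (auto simp: corner_simplex_def lebesgue_pow_def space_PiM)
  also have "\<dots> \<in> sets (lebesgue_pow d)"
    unfolding lebesgue_pow_def by measurable
  finally show ?thesis .
qed

text \<open>
  Integrating out the last coordinate is a Beta integral that replaces \<open>\<beta>\<close> by \<open>\<alpha> (Suc d) + \<beta>\<close>.
\<close>
lemma nn_integral_dirichlet_finite:
  assumes "\<And>i. i \<in> {1..d} \<Longrightarrow> \<alpha> i > 0" "\<beta> > 0"
  shows "(\<integral>\<^sup>+t. ennreal (indicator (corner_simplex d) t * ((\<Prod>i=1..d. t i powr (\<alpha> i - 1)) *
      (1 - (\<Sum>i=1..d. t i)) powr (\<beta> - 1))) \<partial>lebesgue_pow d) < \<infinity>"
  using assms
proof (induction d arbitrary: \<beta>)
  case 0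
  \<comment> \<open>The product over no coordinates is the counting measure on one point, so the
    integral is a single real value.\<close>
  then show ?case by (simp add: lebesgue_pow_def nn_integral_count_space_finite PiM_empty)
next
  case (Suc d)
  interpret product_sigma_finite "\<lambda>_::nat. lborel :: real measure" ..
  let ?F = "\<lambda>d \<beta> t. indicator (corner_simplex d) t * ((\<Prod>i=1..d. t i powr (\<alpha> i - 1)) *
      (1 - (\<Sum>i=1..d. t i)) powr (\<beta> - 1))"
  let ?B = "Beta (\<alpha> (Suc d)) \<beta>"
  have \<alpha>: "\<alpha> (Suc d) > 0" using Suc.prems by simp
  have atMost: "{1..Suc d} = insert (Suc d) {1..d}" by auto
  have meas: "(\<lambda>t. ennreal (?F d \<beta> t)) \<in> borel_measurable (lebesgue_pow d)" for d \<beta>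
    using sets_corner_simplex[of d] unfolding lebesgue_pow_def by measurable
  have inner: "(\<integral>\<^sup>+y. ennreal (?F (Suc d) \<beta> (t(Suc d := y))) \<partial>lborel)
      = ennreal ?B * ennreal (?F d (\<alpha> (Suc d) + \<beta>) t)"
    if t: "t \<in> space (lebesgue_pow d)" for t
  proof -
    let ?r = "1 - (\<Sum>i=1..d. t i)"
    let ?c = "indicator (corner_simplex d) t * (\<Prod>i=1..d. t i powr (\<alpha> i - 1))"
    have c: "?c \<ge> 0" by (auto intro!: mult_nonneg_nonneg prod_nonneg)
    have sum: "(\<Sum>i=1..d. (t(Suc d := y)) i) = (\<Sum>i=1..d. t i)" for y
      by (intro sum.cong) auto
    have prod: "(\<Prod>i=1..d. (t(Suc d := y)) i powr (\<alpha> i - 1)) = (\<Prod>i=1..d. t i powr (\<alpha> i - 1))" for y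
      by (intro prod.cong) auto
    \<comment> \<open>The fibre of the larger simplex over \<open>t\<close> is the interval from 0
      to the slack \<open>?r\<close>.\<close>
    have "t(Suc d := y) \<in> corner_simplex (Suc d) \<longleftrightarrow> t \<in> corner_simplex d \<and> y \<in> {0..?r}" for y
    proof -
      have "t \<in> {1..d} \<rightarrow>\<^sub>E UNIV" "t(Suc d := y) \<in> {1..Suc d} \<rightarrow>\<^sub>E UNIV"
        using t by (auto simp: lebesgue_pow_def space_PiM PiE_iff extensional_def)
      then show ?thesis
        by (auto simp: corner_simplex_def sum atMost)
    qed
    then have ind: "indicator (corner_simplex (Suc d)) (t(Suc d := y))
        = (indicator (corner_simplex d) t * indicator {0..?r} y :: real)" for y
      by (auto simp: indicator_def)
    have "?F (Suc d) \<beta> (t(Suc d := y))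
        = ?c * (indicator {0..?r} y * (y powr (\<alpha> (Suc d) - 1) * (?r - y) powr (\<beta> - 1)))" for y
      by (simp add: ind sum prod algebra_simps)
    then have "(\<integral>\<^sup>+y. ennreal (?F (Suc d) \<beta> (t(Suc d := y))) \<partial>lborel)
        = ennreal ?c * (\<integral>\<^sup>+y. ennreal (indicator {0..?r} y *
            (y powr (\<alpha> (Suc d) - 1) * (?r - y) powr (\<beta> - 1))) \<partial>lborel)"
      using c by (simp only: ennreal_mult') (subst nn_integral_cmult; simp)
    also have "\<dots> = ennreal ?B * ennreal (?F d (\<alpha> (Suc d) + \<beta>) t)"
    \<comment> \<open>Inside the simplex the slack is nonnegative, as the Beta integral requires,
      and its power is the last Dirichlet factor for the new parameter; outside, both sides are
      0.\<close>
    proof (cases "t \<in> corner_simplex d")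
      case True
      then have "?r \<ge> 0" by (simp add: corner_simplex_def)
      with True \<alpha> Suc.prems(2) c show ?thesis
        by (subst nn_integral_Beta_scaled)
          (simp_all add: ennreal_mult'[symmetric] ennreal_mult''[symmetric] prod_nonneg mult_ac)
    qed simp
    finally show ?thesis .
  qed
  have "(\<integral>\<^sup>+t. ennreal (?F (Suc d) \<beta> t) \<partial>lebesgue_pow (Suc d))
      = (\<integral>\<^sup>+t. \<integral>\<^sup>+y. ennreal (?F (Suc d) \<beta> (t(Suc d := y))) \<partial>lborel \<partial>lebesgue_pow d)"
    using meas[of "Suc d" \<beta>] unfolding lebesgue_pow_def atMost
    by (intro product_nn_integral_insert) auto
  also have "\<dots> = (\<integral>\<^sup>+t. ennreal ?B * ennreal (?F d (\<alpha> (Suc d) + \<beta>) t) \<partial>lebesgue_pow d)"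
    by (intro nn_integral_cong inner)
  also have "\<dots> = ennreal ?B * (\<integral>\<^sup>+t. ennreal (?F d (\<alpha> (Suc d) + \<beta>) t) \<partial>lebesgue_pow d)"
    by (intro nn_integral_cmult meas)
  also have "\<dots> < \<infinity>"
    using Suc.IH[of "\<alpha> (Suc d) + \<beta>"] Suc.prems \<alpha> by (simp add: ennreal_mult_less_top)
  finally show ?case .
qed

section \<open>Barycentric coordinates on the simplex\<close>

lemma with_last_less [simp]: "i < n \<Longrightarrow> with_last n t i = t i"
  by (simp add: with_last_def)

lemma with_last_self: "with_last n t n = 1 - (\<Sum>i=1..n - 1. t i)"
  by (simp add: with_last_def)

lemma sum_with_last:
  assumes "n \<ge> 1"
  shows "(\<Sum>i=1..n. with_last n t i) = 1"
proof -
  have "{1..n} = insert n {1..n - 1}" using assms by auto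
  moreover have "(\<Sum>i=1..n - 1. with_last n t i) = (\<Sum>i=1..n - 1. t i)"
    using assms by (intro sum.cong) auto
  ultimately show ?thesis using assms by (simp add: with_last_self)
qed

lemma with_last_nonneg:
  assumes "t \<in> corner_simplex (n - 1)" "i \<in> {1..n}"
  shows "with_last n t i \<ge> 0"
  using assms by (auto simp: with_last_def corner_simplex_def)

lemma coord_prod_nonneg:
  assumes "t \<in> corner_simplex (n - 1)"
  shows "coord_prod n t \<ge> 0"
  unfolding coord_prod_def by (intro prod_nonneg with_last_nonneg[OF assms])

lemma coord_prod_le:
  assumes "n \<ge> 1" "t \<in> corner_simplex (n - 1)"
  shows "coord_prod n t \<le> 1 / real n ^ n"
  using prod_le_sum_1_power_card[of "{1..n}" "with_last n t", OF _ sum_with_last[OF assms(1)]]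
    with_last_nonneg[OF assms(2)]
  by (simp add: coord_prod_def)

lemma borel_measurable_with_last:
  assumes "i \<in> {1..n}"
  shows "(\<lambda>t. with_last n t i) \<in> borel_measurable (lebesgue_pow (n - 1))"
proof (cases "i = n")
  case True
  then show ?thesis by (simp add: with_last_def lebesgue_pow_def)
next
  case False
  with assms have "i \<in> {1..n - 1}" by auto
  then show ?thesis using False by (simp add: with_last_def lebesgue_pow_def)
qed

lemma borel_measurable_coord_prod [measurable]:
  "coord_prod n \<in> borel_measurable (lebesgue_pow (n - 1))"
  unfolding coord_prod_def[abs_def] by (intro borel_measurable_prod borel_measurable_with_last)

section \<open>Integrability and positivity for the Dirichlet weight\<close>

text \<open>The unnormalised Dirichlet density; with \<open>\<alpha> i = \<phi> i / k\<close> it is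
  the factor shared by both integrands.\<close>

definition simplex_weight :: "nat \<Rightarrow> (nat \<Rightarrow> real) \<Rightarrow> (nat \<Rightarrow> real) \<Rightarrow> real" where
  "simplex_weight n \<alpha> t = (\<Prod>i=1..n. with_last n t i powr (\<alpha> i - 1))"

lemma simplex_weight_nonneg: "simplex_weight n \<alpha> t \<ge> 0"
  unfolding simplex_weight_def by (intro prod_nonneg) auto

lemma borel_measurable_simplex_weight [measurable]:
  "simplex_weight n \<alpha> \<in> borel_measurable (lebesgue_pow (n - 1))"
  unfolding simplex_weight_def[abs_def]
  by (intro borel_measurable_prod powr_real_measurable borel_measurable_with_last) auto

lemma set_integrable_simplex_weight:
  assumes "n \<ge> 1" "\<And>i. i \<in> {1..n} \<Longrightarrow> \<alpha> i > 0"
  shows "set_integrable (lebesgue_pow (n - 1)) (corner_simplex (n - 1)) (simplex_weight n \<alpha>)"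
proof -
  have "{1..n} = insert n {1..n - 1}" using assms(1) by auto
  moreover have "(\<Prod>i=1..n - 1. with_last n t i powr (\<alpha> i - 1)) =
      (\<Prod>i=1..n - 1. t i powr (\<alpha> i - 1))" for t
    using assms(1) by (intro prod.cong) auto
  ultimately have eq: "simplex_weight n \<alpha> t = (\<Prod>i=1..n - 1. t i powr (\<alpha> i - 1)) *
      (1 - (\<Sum>i=1..n - 1. t i)) powr (\<alpha> n - 1)" for t
    using assms(1) by (simp add: simplex_weight_def with_last_self mult.commute)
  have "(\<integral>\<^sup>+t. ennreal (indicator (corner_simplex (n - 1)) t * simplex_weight n \<alpha> t)
      \<partial>lebesgue_pow (n - 1)) < \<infinity>"
    unfolding eq by (intro nn_integral_dirichlet_finite) (use assms in auto)
  then show ?thesis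
    unfolding set_integrable_def real_scaleR_def
    by (intro integrableI_nonneg; measurable?) (simp_all add: simplex_weight_nonneg)
qed

lemma set_integrable_simplex_weight_mult:
  assumes "n \<ge> 1" "\<And>i. i \<in> {1..n} \<Longrightarrow> \<alpha> i > 0"
    and "f \<in> borel_measurable (lebesgue_pow (n - 1))"
    and "\<And>t. t \<in> corner_simplex (n - 1) \<Longrightarrow> \<bar>f t\<bar> \<le> 1"
  shows "set_integrable (lebesgue_pow (n - 1)) (corner_simplex (n - 1))
    (\<lambda>t. simplex_weight n \<alpha> t * f t)"
proof (rule set_integrable_bound[OF set_integrable_simplex_weight[OF assms(1,2)]])
  show "set_borel_measurable (lebesgue_pow (n - 1)) (corner_simplex (n - 1))
      (\<lambda>t. simplex_weight n \<alpha> t * f t)"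
    using assms(3) unfolding set_borel_measurable_def by measurable
  show "AE t in lebesgue_pow (n - 1). t \<in> corner_simplex (n - 1) \<longrightarrow>
      norm (simplex_weight n \<alpha> t * f t) \<le> norm (simplex_weight n \<alpha> t)"
    using assms(4) by (auto simp: abs_mult intro!: AE_I2 mult_right_le_one_le)
qed

text \<open>Strict positivity permits the final division. The integrand is nonnegative, and nonzero
  on a box of positive measure.\<close>

lemma beta_k_pos:
  assumes "n \<ge> 1" "k > 0" "\<And>i. i \<in> {1..n} \<Longrightarrow> \<phi> i > 0"
  shows "beta_k n k \<phi> \<eta> > 0"
proof -
  interpret product_sigma_finite "\<lambda>_::nat. lborel :: real measure" ..
  let ?M = "lebesgue_pow (n - 1)" and ?S = "corner_simplex (n - 1)"
  let ?g = "\<lambda>t. simplex_weight n (\<lambda>i. \<phi> i / k) t * exp (- (\<eta> powr k / (k * coord_prod n t)))"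
  \<comment> \<open>With sides \<open>1 / real n\<close> the \<open>n - 1\<close> free coordinates
    sum to less than 1, which keeps the last coordinate positive too.\<close>
  define Q where "Q = ({1..n - 1} \<rightarrow>\<^sub>E {0<..<1 / real n})"
  have int: "set_integrable ?M ?S ?g"
  proof (rule set_integrable_simplex_weight_mult)
    show "(\<lambda>t. exp (- (\<eta> powr k / (k * coord_prod n t)))) \<in> borel_measurable ?M"
      by measurable
    show "\<bar>exp (- (\<eta> powr k / (k * coord_prod n t)))\<bar> \<le> 1" if "t \<in> ?S" for t
      using coord_prod_nonneg[OF that] assms(2) by simp
    show "\<phi> i / k > 0" if "i \<in> {1..n}" for i
      using assms(2,3) that by simp
  qed (fact assms(1))
  have nonneg: "0 \<le> indicator ?S t *\<^sub>R ?g t" for t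
    using simplex_weight_nonneg by simp
  have Q: "indicator ?S t *\<^sub>R ?g t \<noteq> 0" if "t \<in> Q" for t
  proof -
    have ti: "0 < t i \<and> t i < 1 / real n" if "i \<in> {1..n - 1}" for i
      using \<open>t \<in> Q\<close> that by (auto simp: Q_def PiE_iff)
    have "(\<Sum>i=1..n - 1. t i) \<le> (\<Sum>i=1..n - 1. 1 / real n)"
      using ti by (intro sum_mono) (simp add: less_imp_le)
    also have "\<dots> < 1" using assms(1) by (simp add: field_simps)
    finally have s: "(\<Sum>i=1..n - 1. t i) < 1" .
    then have "t \<in> ?S" using ti that by (auto simp: corner_simplex_def Q_def PiE_iff less_imp_le)
    moreover have "with_last n t i \<noteq> 0" if "i \<in> {1..n}" for i
    proof (cases "i = n")
      case False
      with that have "i \<in> {1..n - 1}" by auto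
      from ti[OF this] False show ?thesis by (simp add: with_last_def)
    qed (use s in \<open>simp add: with_last_self\<close>)
    ultimately show ?thesis by (auto simp: simplex_weight_def)
  qed
  have "emeasure ?M Q = (\<Prod>i=1..n - 1. ennreal (1 / real n))"
    unfolding Q_def lebesgue_pow_def by (subst emeasure_PiM) auto
  also have "\<dots> > 0" using assms(1) by (simp add: ennreal_power)
  finally have "emeasure ?M Q > 0" .
  moreover have "Q \<in> sets ?M"
    unfolding Q_def lebesgue_pow_def by (intro sets_PiM_I_finite) auto
  ultimately have "\<not> (AE t in ?M. t \<notin> Q)"
    by (simp add: AE_iff_null_sets[symmetric] null_sets_def)
  moreover have "AE t in ?M. t \<notin> Q" if "AE t in ?M. indicator ?S t *\<^sub>R ?g t = 0"
    using that by (rule AE_mp) (use Q in auto)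
  ultimately have "\<not> (AE t in ?M. indicator ?S t *\<^sub>R ?g t = 0)"
    by blast
  \<comment> \<open>An integrable nonnegative function with integral 0 vanishes almost
    everywhere.\<close>
  then have "(LINT t:?S|?M. ?g t) \<noteq> 0"
    using integral_nonneg_eq_0_iff_AE[of ?M "\<lambda>t. indicator ?S t *\<^sub>R ?g t"] int nonneg
    unfolding set_lebesgue_integral_def set_integrable_def by simp
  moreover have "(LINT t:?S|?M. ?g t) \<ge> 0"
    unfolding set_lebesgue_integral_def by (intro Bochner_Integration.integral_nonneg nonneg)
  ultimately show ?thesis
    using assms(2) by (simp add: beta_k_def simplex_weight_def)
qed

section \<open>Pointwise estimates and their integration\<close>

text \<open>Kummer's transformation leaves \<open>exp (- x)\<close> times a series lying between 1
  and \<open>exp x\<close>.\<close>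

lemma hyp1F1_k_neg_bounds:
  assumes "0 < a" "a < b" "k \<ge> 0" "0 \<le> x"
  shows "0 \<le> hyp1F1_k k a b (- x)" "hyp1F1_k k a b (- x) \<le> 1"
  using hyp1F1_k_ge_1[of "b - a" b k x] hyp1F1_k_le_exp[of "b - a" b k x] assms
  by (simp_all add: hyp1F1_k_kummer exp_minus field_simps)

text \<open>Apply Kummer's transformation at \<open>x + y\<close>, then lower the series argument to
  \<open>x0\<close> and \<open>exp (- y)\<close> to \<open>exp (- y0)\<close>. The factor
  \<open>exp (- x)\<close> is kept exactly, since it is the exponential in
  \<open>beta_k\<close>.\<close>

lemma hyp1F1_k_neg_ge:
  assumes "0 < a" "a < b" "k \<ge> 0" "0 \<le> x0" "x0 \<le> x" "y \<le> y0" "0 \<le> y"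
  shows "hyp1F1_k k (b - a) b x0 * exp (- y0) * exp (- x) \<le> hyp1F1_k k a b (- x - y)"
proof -
  have "hyp1F1_k k (b - a) b x0 * exp (- y0) \<le> hyp1F1_k k (b - a) b (x + y) * exp (- y)"
    using assms hyp1F1_k_ge_1[of "b - a" b k "x + y"]
    by (intro mult_mono hyp1F1_k_mono) auto
  from mult_right_mono[OF this, of "exp (- x)"]
  have "hyp1F1_k k (b - a) b x0 * exp (- y0) * exp (- x)
      \<le> exp (- (x + y)) * hyp1F1_k k (b - a) b (x + y)"
    by (simp add: exp_add exp_diff exp_minus field_simps)
  also have "\<dots> = hyp1F1_k k a b (- x - y)"
    using hyp1F1_k_kummer[of a b k "x + y"] assms by simp
  finally show ?thesis .
qed

theorem theorem2p4:
  fixes n :: nat and k a b \<eta> \<zeta> :: real and \<phi> :: "nat \<Rightarrow> real"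
  assumes "n \<ge> 2" and "k > 0" and "a > 0" and "b - a > 0" and "\<eta> > 0" and "\<zeta> \<ge> 0"
    and "\<And>i. i \<in> {1..n} \<Longrightarrow> \<phi> i > 0"
  shows "beta_1F1_k n k \<zeta> a b \<phi> \<eta> / beta_k n k \<phi> \<eta>
    \<ge> hyp1F1_k k (b - a) b (\<eta> powr k * real n ^ n / k)
        * exp (- (\<zeta> powr k / (\<eta> powr k * real n ^ n)))"
proof -
  let ?M = "lebesgue_pow (n - 1)" and ?S = "corner_simplex (n - 1)"
  let ?w = "simplex_weight n (\<lambda>i. \<phi> i / k)"
  let ?x = "\<lambda>t. \<eta> powr k / (k * coord_prod n t)"
  let ?y = "\<lambda>t. \<zeta> powr k * (coord_prod n t / \<eta> powr k)"
  let ?C = "hyp1F1_k k (b - a) b (\<eta> powr k * real n ^ n / k)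
    * exp (- (\<zeta> powr k / (\<eta> powr k * real n ^ n)))"
  have n: "n \<ge> 1" using assms(1) by simp
  have \<alpha>: "\<phi> i / k > 0" if "i \<in> {1..n}" for i using assms that by simp
  note \<pi> = coord_prod_nonneg
  have x: "?x t \<ge> 0" and y: "?y t \<ge> 0" if "t \<in> ?S" for t
    using \<pi>[OF that] assms by simp_all
  have int_exp: "set_integrable ?M ?S (\<lambda>t. ?w t * exp (- ?x t))"
  proof (intro set_integrable_simplex_weight_mult n \<alpha>)
    show "(\<lambda>t. exp (- ?x t)) \<in> borel_measurable ?M"
      by measurable
    show "\<bar>exp (- ?x t)\<bar> \<le> 1" if "t \<in> ?S" for t
      using x[OF that] by simp
  qed
  have int_hyp: "set_integrable ?M ?S (\<lambda>t. ?w t * hyp1F1_k k a b (- ?x t - ?y t))"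
  proof (intro set_integrable_simplex_weight_mult n \<alpha>)
    show "(\<lambda>t. hyp1F1_k k a b (- ?x t - ?y t)) \<in> borel_measurable ?M"
      by measurable
    show "\<bar>hyp1F1_k k a b (- ?x t - ?y t)\<bar> \<le> 1" if "t \<in> ?S" for t
      using hyp1F1_k_neg_bounds[of a b k "?x t + ?y t"] x[OF that] y[OF that] assms by simp
  qed
  have pointwise: "?C * (?w t * exp (- ?x t)) \<le> ?w t * hyp1F1_k k a b (- ?x t - ?y t)"
    if t: "t \<in> ?S" for t
  \<comment> \<open>Here the totalised division makes \<open>?x t\<close> equal to 0, so AM-GM gives
    no bound; but some coordinate is 0, hence the weight is 0 and both sides vanish.\<close>
  proof (cases "coord_prod n t = 0")
    case True
    then have "?w t = 0" by (auto simp: coord_prod_def simplex_weight_def)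
    then show ?thesis by simp
  next
    case False
    then have pos: "coord_prod n t > 0" using \<pi>[OF t] by simp
    \<comment> \<open>AM-GM serves twice: inverted it bounds \<open>?x t\<close> from below,
      directly it bounds \<open>?y t\<close> from above.\<close>
    have le: "coord_prod n t * real n ^ n \<le> 1"
      using coord_prod_le[OF n t] n by (simp add: field_simps)
    have "\<eta> powr k * real n ^ n / k \<le> ?x t"
      using le pos assms mult_left_mono[OF le, of "\<eta> powr k"] by (simp add: field_simps)
    moreover have "?y t \<le> \<zeta> powr k / (\<eta> powr k * real n ^ n)"
      using mult_left_mono[OF coord_prod_le[OF n t], of "\<zeta> powr k / \<eta> powr k"]
      by (simp add: field_simps)
    ultimately have "?C * exp (- ?x t) \<le> hyp1F1_k k a b (- ?x t - ?y t)"
      using y[OF t] assms by (intro hyp1F1_k_neg_ge) auto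
    from mult_left_mono[OF this simplex_weight_nonneg] show ?thesis
      by (simp add: mult_ac)
  qed
  have "?C * (LINT t:?S|?M. ?w t * exp (- ?x t)) = (LINT t:?S|?M. ?C * (?w t * exp (- ?x t)))"
    by (rule set_integral_mult_right[symmetric])
  also have "\<dots> \<le> (LINT t:?S|?M. ?w t * hyp1F1_k k a b (- ?x t - ?y t))"
    using int_exp int_hyp pointwise by (intro set_integral_mono set_integrable_mult_right)
  finally have "1 / k ^ (n - 1) * (?C * (LINT t:?S|?M. ?w t * exp (- ?x t)))
      \<le> 1 / k ^ (n - 1) * (LINT t:?S|?M. ?w t * hyp1F1_k k a b (- ?x t - ?y t))"
    using assms(2) by (intro mult_left_mono) auto
  then have "?C * beta_k n k \<phi> \<eta> \<le> beta_1F1_k n k \<zeta> a b \<phi> \<eta>"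
    unfolding beta_k_def beta_1F1_k_def simplex_weight_def by (simp only: mult.left_commute)
  then show ?thesis
    using beta_k_pos[OF n assms(2,7)] by (simp add: pos_le_divide_eq)
qed

end
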